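(* Let $X$ be a complex Banach space and let $A$ be the generator of a quasi-multiplication semigroup $(T(t))_{t\ge0}$ on $X$. Suppose that $s(A)=0$ but $\sigma(A)\cap i\mathbb{R}=\emptyset$, and let $M\colon\mathbb{R}_+\to(0,\infty)$ be defined by $M(s)=\sup_{|r|\le s}\|R(ir,A)\|$, $s\ge0$. Then $$\|T(t)A^{-1}\| \sim \frac{1}{M_{\max}^{-1}(t)},\quad t\to\infty,$$ where $M_{\max}\colon[1,\infty)\to\mathbb{R}_+$ is defined by $$M_{\max}(s)=\max_{1\le\lambda\le s}M(\lambda^{-1} s)\log\lambda,\quad s\ge1.$$
   Context: $\mathbb{R}_+=[0,\infty)$. For a closed operator $A$, $\sigma(A)$ is its spectrum, $\rho(A)=\mathbb{C}\setminus\sigma(A)$ and $R(z,A)=(zI-A)^{-1}$ for $z\in\rho(A)$. The spectral bound is $s(A)=\sup_{z\in\sigma(A)}\operatorname{Re} z$. A $C_0$-semigroup $(T(t))_{t\ge0}$ on $X$ with generator $A$ is a quasi-multiplication semigroup if $$\|T(t)R(\lambda,A)\|=\sup_{z\in\sigma(A)}\frac{e^{t\operatorname{Re} z}}{|\lambda-z|},\quad t\ge0,$$ for every $\lambda\in\rho(A)$. For a continuous non-decreasing function $F\colon[a,\infty)\to[0,\infty)$ with $F(s)\to\infty$ as $s\to\infty$, $F^{-1}$ denotes its right-continuous right-inverse $F^{-1}(t)=\sup\{r\ge a: F(r)\le t\}$, $t\ge F(a)$. $f(t)\sim g(t)$, $t\to\infty$, means $f(t)/g(t)\to1$ as $t\to\infty$.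 *)

theory Defs
  imports "HOL-Analysis.Analysis" "HOL-Library.Landau_Symbols"
begin

text \<open>
  Complex Banach spaces. The norm and the completeness come from the underlying real Banach
  space; \<open>scaleC\<close> is a complex scalar multiplication extending \<open>scaleR\<close>.
\<close>

class scaleC =
  fixes scaleC :: "complex \<Rightarrow> 'a \<Rightarrow> 'a"  (infixr \<open>*\<^sub>C\<close> 75)

class complex_banach = banach + scaleC +
  assumes scaleC_add_right: "c *\<^sub>C (x + y) = c *\<^sub>C x + c *\<^sub>C y"
    and scaleC_add_left: "(c + d) *\<^sub>C x = c *\<^sub>C x + d *\<^sub>C x"
    and scaleC_scaleC: "c *\<^sub>C d *\<^sub>C x = (c * d) *\<^sub>C x"
    and scaleC_of_real: "complex_of_real r *\<^sub>C x = r *\<^sub>R x"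
    and norm_scaleC: "norm (c *\<^sub>C x) = cmod c * norm x"

instantiation complex :: complex_banach
begin

definition scaleC_complex :: "complex \<Rightarrow> complex \<Rightarrow> complex" where
  "scaleC_complex c x = c * x"

instance
  by standard (auto simp: scaleC_complex_def algebra_simps norm_mult scaleR_conv_of_real)

end

text \<open>
  A possibly unbounded operator on \<open>'a\<close> is a partial function \<open>A :: 'a \<rightharpoonup> 'a\<close>, with domain
  \<open>dom A\<close>. Bounded operators have type \<open>'a \<Rightarrow>\<^sub>L 'a\<close>, whose norm is the operator norm. That type
  only records real linearity. Semigroup operators are required to be complex linear
  explicitly; the inverse of a complex linear operator is complex linear automatically.
\<close>

definition is_bounded_inverse :: "('a::real_normed_vector \<rightharpoonup> 'a) \<Rightarrow> ('a \<Rightarrow>\<^sub>L 'a) \<Rightarrow> bool" where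
  "is_bounded_inverse B S \<longleftrightarrow>
     (\<forall>y. B (blinfun_apply S y) = Some y) \<and>
     (\<forall>x y. B x = Some y \<longrightarrow> blinfun_apply S y = x)"

definition boundedly_invertible :: "('a::real_normed_vector \<rightharpoonup> 'a) \<Rightarrow> bool" where
  "boundedly_invertible B \<longleftrightarrow> (\<exists>S. is_bounded_inverse B S)"

definition bounded_inverse :: "('a::real_normed_vector \<rightharpoonup> 'a) \<Rightarrow> 'a \<Rightarrow>\<^sub>L 'a" where
  "bounded_inverse B = (THE S. is_bounded_inverse B S)"

lemma is_bounded_inverse_unique:
  assumes "is_bounded_inverse B S" "is_bounded_inverse B S'"
  shows "S = S'"
  using assms unfolding is_bounded_inverse_def by (metis blinfun_eqI)

lemma bounded_inverse_eqI:
  assumes "is_bounded_inverse B S"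
  shows "bounded_inverse B = S"
  unfolding bounded_inverse_def
  using assms is_bounded_inverse_unique by blast

text \<open>The operator \<open>zI - A\<close>, with the same domain as \<open>A\<close>.\<close>

definition shifted :: "complex \<Rightarrow> ('a::complex_banach \<rightharpoonup> 'a) \<Rightarrow> ('a \<rightharpoonup> 'a)" where
  "shifted z A = (\<lambda>x. map_option (\<lambda>y. z *\<^sub>C x - y) (A x))"

definition resolvent_set :: "('a::complex_banach \<rightharpoonup> 'a) \<Rightarrow> complex set" where
  "resolvent_set A = {z. boundedly_invertible (shifted z A)}"

definition spectrum :: "('a::complex_banach \<rightharpoonup> 'a) \<Rightarrow> complex set" where
  "spectrum A = - resolvent_set A"

definition resolvent :: "complex \<Rightarrow> ('a::complex_banach \<rightharpoonup> 'a) \<Rightarrow> 'a \<Rightarrow>\<^sub>L 'a" where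
  "resolvent z A = bounded_inverse (shifted z A)"

text \<open>Extended real valued: \<open>-\<infinity>\<close> for empty spectrum, \<open>\<infinity>\<close> if the real parts are unbounded above.\<close>

definition spectral_bound :: "('a::complex_banach \<rightharpoonup> 'a) \<Rightarrow> ereal" where
  "spectral_bound A = (SUP z\<in>spectrum A. ereal (Re z))"

text \<open>Only the values \<open>T t\<close> with \<open>t \<ge> 0\<close> are meaningful.\<close>

definition C0_semigroup :: "(real \<Rightarrow> ('a::complex_banach \<Rightarrow>\<^sub>L 'a)) \<Rightarrow> bool" where
  "C0_semigroup T \<longleftrightarrow>
     (\<forall>t\<ge>0. \<forall>c x. T t (c *\<^sub>C x) = c *\<^sub>C T t x) \<and>
     T 0 = id_blinfun \<and>
     (\<forall>s\<ge>0. \<forall>t\<ge>0. T (s + t) = T s o\<^sub>L T t) \<and>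
     (\<forall>x. ((\<lambda>t. T t x) \<longlongrightarrow> x) (at_right 0))"

definition generator :: "(real \<Rightarrow> ('a::complex_banach \<Rightarrow>\<^sub>L 'a)) \<Rightarrow> ('a \<rightharpoonup> 'a)" where
  "generator T = (\<lambda>x.
     let q = (\<lambda>t. (1 / t) *\<^sub>R (T t x - x)) in
     if \<exists>y. (q \<longlongrightarrow> y) (at_right 0) then Some (Lim (at_right 0) q) else None)"

lemma generator_eq_Some_iff:
  "generator T x = Some y \<longleftrightarrow> ((\<lambda>t. (1 / t) *\<^sub>R (T t x - x)) \<longlongrightarrow> y) (at_right 0)"
  by (auto simp: generator_def Let_def tendsto_Lim intro: tendsto_unique[OF trivial_limit_at_right_real])

text \<open>
  The supremum is taken in the extended reals, so that the equation includes its finiteness.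
\<close>

definition quasi_multiplication_semigroup ::
    "(real \<Rightarrow> ('a::complex_banach \<Rightarrow>\<^sub>L 'a)) \<Rightarrow> bool" where
  "quasi_multiplication_semigroup T \<longleftrightarrow>
     C0_semigroup T \<and>
     (\<forall>\<mu>\<in>resolvent_set (generator T). \<forall>t\<ge>0.
        ereal (norm (T t o\<^sub>L resolvent \<mu> (generator T))) =
        (SUP z\<in>spectrum (generator T). ereal (exp (t * Re z) / cmod (\<mu> - z))))"

text \<open>
  The right-continuous right-inverse of a continuous non-decreasing \<open>F\<close> on \<open>[a, \<infinity>)\<close> with
  \<open>F s \<rightarrow> \<infinity>\<close>; meaningful for \<open>t \<ge> F a\<close>, where the set is nonempty and bounded.
\<close>

definition right_inverse :: "real \<Rightarrow> (real \<Rightarrow> real) \<Rightarrow> real \<Rightarrow> real" where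
  "right_inverse a F t = Sup {r. a \<le> r \<and> F r \<le> t}"

end

theory Submission
  imports Defs
begin

text \<open>
  Write \<open>S\<close> for the spectrum and \<open>d s\<close> for the distance of \<open>S\<close> from the segment
  \<open>\<i>[-s, s]\<close>. The quasi-multiplication property gives \<open>M s = 1 / d s\<close> and
  \<open>\<parallel>T t A\<inverse>\<parallel> = sup {exp (t Re z) / \<bar>z\<bar> | z \<in> S}\<close>. Substituting \<open>s = r / \<lambda>\<close>, the inequality
  \<open>Mmax r \<le> t\<close> becomes \<open>r \<le> s exp (t d s)\<close> for all \<open>s \<ge> 1\<close>, so the right-inverse of \<open>Mmax\<close> at
  \<open>t\<close> is the infimum of \<open>s exp (t d s)\<close> over \<open>s \<ge> 1\<close>. The two suprema
  \<open>sup exp (t Re z) / \<bar>z\<bar>\<close> and \<open>sup exp (- t d s) / s\<close> are then compared: a point \<open>z \<in> S\<close>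
  is matched with \<open>s = \<bar>Im z\<bar>\<close>, and \<open>s\<close> with a point of \<open>S\<close> almost nearest to the segment,
  which has modulus at most \<open>s + d s\<close> up to an arbitrarily small error. As \<open>t \<rightarrow> \<infinity>\<close> only large
  \<open>s\<close> matter, and \<open>d s / s \<rightarrow> 0\<close>.
\<close>

section \<open>Distance from a set to a segment of the imaginary axis\<close>

definition segment_dist :: "complex set \<Rightarrow> real \<Rightarrow> real" where
  "segment_dist S s = (INF r\<in>{-s..s}. infdist (\<i> * complex_of_real r) S)"

definition dist_weight :: "complex set \<Rightarrow> real \<Rightarrow> real" where
  "dist_weight S t = (INF s\<in>{1..}. s * exp (t * segment_dist S s))"

lemma segment_dist_attained:
  assumes "s \<ge> 0"
  obtains r where "\<bar>r\<bar> \<le> s" "segment_dist S s = infdist (\<i> * complex_of_real r) S"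
    "\<And>r'. \<bar>r'\<bar> \<le> s \<Longrightarrow> infdist (\<i> * complex_of_real r) S \<le> infdist (\<i> * complex_of_real r') S"
proof -
  have "continuous_on {-s..s} (\<lambda>r. infdist (\<i> * complex_of_real r) S)"
    by (intro continuous_intros)
  moreover have "{-s..s} \<noteq> {}"
    using assms by simp
  ultimately have "\<exists>r\<in>{-s..s}. \<forall>r'\<in>{-s..s}.
      infdist (\<i> * complex_of_real r) S \<le> infdist (\<i> * complex_of_real r') S"
    by (intro continuous_attains_inf compact_Icc)
  then obtain r where r: "r \<in> {-s..s}"
    "\<And>r'. r' \<in> {-s..s} \<Longrightarrow> infdist (\<i> * complex_of_real r) S \<le> infdist (\<i> * complex_of_real r') S"
    by blast
  then have "segment_dist S s = infdist (\<i> * complex_of_real r) S"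
    unfolding segment_dist_def by (intro cInf_eq_minimum) auto
  with r show thesis
    by (intro that[of r]) (auto simp: abs_le_iff)
qed

lemma segment_dist_le_infdist:
  "\<bar>r\<bar> \<le> s \<Longrightarrow> segment_dist S s \<le> infdist (\<i> * complex_of_real r) S"
  by (metis abs_ge_zero order.trans segment_dist_attained)

lemma segment_dist_le:
  assumes "z \<in> S" "\<bar>r\<bar> \<le> s"
  shows "segment_dist S s \<le> cmod (\<i> * complex_of_real r - z)"
  using segment_dist_le_infdist[OF assms(2), of S] infdist_le[OF assms(1), of "\<i> * complex_of_real r"]
  by (simp add: dist_norm)

lemma segment_dist_le_Re:
  assumes "z \<in> S" "\<bar>Im z\<bar> \<le> s"
  shows "segment_dist S s \<le> \<bar>Re z\<bar>"
proof -
  have "\<i> * complex_of_real (Im z) - z = complex_of_real (- Re z)"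
    by (simp add: complex_eq_iff)
  then show ?thesis
    using segment_dist_le[OF assms] by simp
qed

lemma segment_dist_antimono:
  assumes "0 \<le> s" "s \<le> s'"
  shows "segment_dist S s' \<le> segment_dist S s"
  using segment_dist_attained[OF assms(1), of S] segment_dist_le_infdist[of _ s' S] assms(2)
  by (metis order.trans)

lemma segment_dist_nonneg: "0 \<le> s \<Longrightarrow> 0 \<le> segment_dist S s"
  by (metis segment_dist_attained infdist_nonneg)

lemma dist_weight_le:
  assumes "t \<ge> 0" "s \<ge> 1"
  shows "dist_weight S t \<le> s * exp (t * segment_dist S s)"
  unfolding dist_weight_def
proof (rule cINF_lower)
  show "bdd_below ((\<lambda>s. s * exp (t * segment_dist S s)) ` {1..})"
    by (rule bdd_belowI[of _ 0]) auto
qed (use assms in auto)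

lemma dist_weight_ge:
  assumes "\<And>s. s \<ge> 1 \<Longrightarrow> c \<le> s * exp (t * segment_dist S s)"
  shows "c \<le> dist_weight S t"
  unfolding dist_weight_def by (rule cINF_greatest) (use assms in auto)

lemma dist_weight_ge_1:
  assumes "t \<ge> 0"
  shows "1 \<le> dist_weight S t"
proof (rule dist_weight_ge)
  fix s :: real assume "s \<ge> 1"
  then show "1 \<le> s * exp (t * segment_dist S s)"
    using assms segment_dist_nonneg[of s S] mult_mono[of 1 s 1 "exp (t * segment_dist S s)"] by simp
qed

section \<open>Sets in the open left half-plane that approach the imaginary axis\<close>

locale left_half_plane_set =
  fixes S :: "complex set"
  assumes Re_neg: "\<And>z. z \<in> S \<Longrightarrow> Re z < 0"
    and Re_approx_0: "\<And>e. e > 0 \<Longrightarrow> \<exists>z\<in>S. - e < Re z"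
    and infdist_imag_pos: "\<And>r. infdist (\<i> * complex_of_real r) S > 0"
begin

lemma nonempty: "S \<noteq> {}"
  using Re_approx_0[of 1] by auto

lemma segment_dist_pos: "s \<ge> 0 \<Longrightarrow> segment_dist S s > 0"
  by (metis segment_dist_attained infdist_imag_pos)

text \<open>A segment that reaches the height of a point \<open>z\<close> of \<open>S\<close> lies
  within |Re z| of it. As the distance never vanishes, it can always be made strictly smaller by
  lengthening the segment.\<close>

lemma segment_dist_small:
  assumes "e > 0"
  obtains s where "s \<ge> 1" "segment_dist S s < e"
proof -
  obtain z where z: "z \<in> S" "- e < Re z"
    using Re_approx_0[OF assms] by blast
  then have "segment_dist S (max 1 \<bar>Im z\<bar>) < e"
    using segment_dist_le_Re[of z S "max 1 \<bar>Im z\<bar>"] Re_neg[of z] by auto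
  then show thesis
    by (intro that[of "max 1 \<bar>Im z\<bar>"]) auto
qed

lemma SUP_inverse_infdist:
  assumes "s \<ge> 0"
  shows "(SUP r\<in>{r. \<bar>r\<bar> \<le> s}. 1 / infdist (\<i> * complex_of_real r) S) = 1 / segment_dist S s"
proof (rule cSup_eq_maximum)
  obtain r where r: "\<bar>r\<bar> \<le> s" "segment_dist S s = infdist (\<i> * complex_of_real r) S"
    using segment_dist_attained[OF assms, of S] by metis
  then show "1 / segment_dist S s \<in> (\<lambda>r. 1 / infdist (\<i> * complex_of_real r) S) ` {r. \<bar>r\<bar> \<le> s}"
    by auto
  show "x \<le> 1 / segment_dist S s"
    if "x \<in> (\<lambda>r. 1 / infdist (\<i> * complex_of_real r) S) ` {r. \<bar>r\<bar> \<le> s}" for x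
    using that segment_dist_le_infdist[of _ s S] segment_dist_pos[OF assms]
    by (auto intro!: divide_left_mono mult_pos_pos infdist_imag_pos)
qed

lemma right_inverse_eq_dist_weight:
  assumes M: "\<And>s. s \<ge> 0 \<Longrightarrow> M s = 1 / segment_dist S s"
    and Mmax: "\<And>s. s \<ge> 1 \<Longrightarrow> Mmax s = (SUP l\<in>{1..s}. M (s / l) * ln l)"
    and t: "t \<ge> 0"
  shows "right_inverse 1 Mmax t = dist_weight S t"
proof -
  have Mmax_le: "Mmax r \<le> t \<longleftrightarrow> r \<le> dist_weight S t" if r: "r \<ge> 1" for r
  proof -
    have pointwise: "M (r / l) * ln l \<le> t \<longleftrightarrow> r \<le> r / l * exp (t * segment_dist S (r / l))"
      if "l \<ge> 1" for l
    proof -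
      have "M (r / l) * ln l \<le> t \<longleftrightarrow> ln l \<le> t * segment_dist S (r / l)"
        using M[of "r / l"] segment_dist_pos[of "r / l"] r that by (simp add: pos_divide_le_eq)
      also have "\<dots> \<longleftrightarrow> l \<le> exp (t * segment_dist S (r / l))"
        using that by (metis exp_le_cancel_iff exp_ln less_le_trans zero_less_one)
      also have "\<dots> \<longleftrightarrow> r \<le> r / l * exp (t * segment_dist S (r / l))"
        using r that by (simp add: field_simps)
      finally show ?thesis .
    qed
    \<comment> \<open>A real supremum can be tested pointwise only if it is over a bounded set. Here
      \<open>M\<close> is non-decreasing, so \<open>l = r\<close> gives a bound.\<close>
    have "bdd_above ((\<lambda>l. M (r / l) * ln l) ` {1..r})"
    proof (rule bdd_aboveI2)
      fix l assume l: "l \<in> {1..r}"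
      have le: "r / l \<le> r"
        using l r by (simp add: field_simps)
      have "M (r / l) \<le> M r"
        using M[of "r / l"] M[of r] segment_dist_antimono[OF _ le, of S] segment_dist_pos[of r]
          segment_dist_pos[of "r / l"] l r
        by (auto intro!: divide_left_mono)
      moreover have "0 \<le> M r"
        using M[of r] segment_dist_pos[of r] r by auto
      ultimately show "M (r / l) * ln l \<le> M r * ln r"
        using l r by (intro mult_mono) auto
    qed
    then have "Mmax r \<le> t \<longleftrightarrow> (\<forall>l\<in>{1..r}. M (r / l) * ln l \<le> t)"
      using r by (simp add: Mmax cSUP_le_iff)
    also have "\<dots> \<longleftrightarrow> (\<forall>l\<in>{1..r}. r \<le> r / l * exp (t * segment_dist S (r / l)))"
      using pointwise by auto
    also have "\<dots> \<longleftrightarrow> r \<le> dist_weight S t"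
    proof
      assume all: "\<forall>l\<in>{1..r}. r \<le> r / l * exp (t * segment_dist S (r / l))"
      show "r \<le> dist_weight S t"
      proof (rule dist_weight_ge)
        fix s :: real assume s: "s \<ge> 1"
        show "r \<le> s * exp (t * segment_dist S s)"
        proof (cases "s \<le> r")
          case True
          then have "r / s \<in> {1..r}"
            using s r by (auto simp: field_simps)
          moreover have "r / (r / s) = s"
            using s r by simp
          ultimately show ?thesis
            using bspec[OF all, of "r / s"] by simp
        next
          \<comment> \<open>The substitution \<open>s = r / l\<close> with \<open>l \<ge> 1\<close>
            only reaches \<open>s \<le> r\<close>. For larger \<open>s\<close> the factor
            \<open>s\<close> alone suffices, as the exponential is at least 1.\<close>
          case False
          then show ?thesis
            using s t segment_dist_nonneg[of s S] mult_mono[of r s 1 "exp (t * segment_dist S s)"]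
            by simp
        qed
      qed
    next
      assume le: "r \<le> dist_weight S t"
      show "\<forall>l\<in>{1..r}. r \<le> r / l * exp (t * segment_dist S (r / l))"
      proof
        fix l assume "l \<in> {1..r}"
        then have "1 \<le> r / l"
          by simp
        from order.trans[OF le dist_weight_le[OF t this]]
        show "r \<le> r / l * exp (t * segment_dist S (r / l))" .
      qed
    qed
    finally show ?thesis .
  qed
  have "{r. 1 \<le> r \<and> Mmax r \<le> t} = {1..dist_weight S t}"
    using Mmax_le by auto
  then show ?thesis
    using dist_weight_ge_1[OF t, of S] by (simp add: right_inverse_def)
qed

text \<open>Some \<open>s'\<close> has a strictly smaller distance than \<open>s\<close>, and the
  exponential gain eventually outweighs any constant factor. Hence no bounded range of
  \<open>s\<close> determines the infimum for large \<open>t\<close>.\<close>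

lemma dist_weight_upper_rate:
  assumes "s \<ge> 0" "c > 0"
  shows "eventually (\<lambda>t. dist_weight S t \<le> c * exp (t * segment_dist S s)) at_top"
proof -
  obtain s' where s': "s' \<ge> 1" "segment_dist S s' < segment_dist S s"
    using segment_dist_small[OF segment_dist_pos[OF assms(1)]] by metis
  define k where "k = segment_dist S s - segment_dist S s'"
  have "k > 0"
    using s' by (simp add: k_def)
  show ?thesis
    \<comment> \<open>From this time on, \<open>s' \<le> c * exp (t * k)\<close>.\<close>
    using eventually_ge_at_top[of "max 0 (ln (s' / c) / k)"]
  proof eventually_elim
    case (elim t)
    then have "ln (s' / c) \<le> t * k"
      using \<open>k > 0\<close> by (simp add: field_simps)
    then have "s' / c \<le> exp (t * k)"
      using s' assms by (metis exp_le_cancel_iff exp_ln divide_pos_pos less_le_trans zero_less_one)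
    then have "s' \<le> c * exp (t * k)"
      using assms by (simp add: field_simps)
    then have "s' * exp (t * segment_dist S s') \<le> c * exp (t * k) * exp (t * segment_dist S s')"
      by (intro mult_right_mono) auto
    also have "\<dots> = c * exp (t * segment_dist S s)"
      by (simp add: k_def flip: exp_add) (simp add: algebra_simps)
    finally show ?case
      using dist_weight_le[of t s' S] elim s' by simp
  qed
qed

text \<open>The choice \<open>s = \<bar>Im z\<bar>\<close> is admissible only when it is at least 1.
  For the remaining \<open>z\<close> both |Re z| and |z| are at least the distance at 1, and
  \<open>dist_weight_upper_rate\<close> with that distance as \<open>c\<close> gives a threshold
  uniform in \<open>z\<close>.\<close>

lemma exp_Re_div_le:
  "eventually (\<lambda>t. \<forall>z\<in>S. exp (t * Re z) / cmod z \<le> 1 / dist_weight S t) at_top"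
proof -
  have d1: "segment_dist S 1 > 0"
    by (rule segment_dist_pos) simp
  show ?thesis
    using eventually_ge_at_top[of 0] dist_weight_upper_rate[OF zero_le_one d1]
  proof eventually_elim
    case (elim t)
    have g: "dist_weight S t > 0"
      using dist_weight_ge_1[of t S] elim by linarith
    show ?case
    proof
      fix z assume z: "z \<in> S"
      then have z0: "cmod z > 0" and Re: "\<bar>Re z\<bar> = - Re z"
        using Re_neg by force+
      have "dist_weight S t \<le> cmod z * exp (t * - Re z)"
      proof (cases "\<bar>Im z\<bar> \<ge> 1")
        case True
        have "t * segment_dist S \<bar>Im z\<bar> \<le> t * - Re z"
          using segment_dist_le_Re[OF z order.refl] Re elim by (intro mult_left_mono) auto
        then have "\<bar>Im z\<bar> * exp (t * segment_dist S \<bar>Im z\<bar>) \<le> cmod z * exp (t * - Re z)"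
          using abs_Im_le_cmod[of z] by (intro mult_mono) auto
        with dist_weight_le[of t "\<bar>Im z\<bar>" S] elim True show ?thesis
          by linarith
      next
        case False
        then have "segment_dist S 1 \<le> - Re z"
          using segment_dist_le_Re[OF z, of 1] Re by simp
        moreover have "- Re z \<le> cmod z"
          using abs_Re_le_cmod[of z] Re by simp
        moreover have "t * segment_dist S 1 \<le> t * - Re z"
          using calculation(1) elim by (intro mult_left_mono) auto
        ultimately have "segment_dist S 1 * exp (t * segment_dist S 1) \<le> cmod z * exp (t * - Re z)"
          using d1 by (intro mult_mono) auto
        with elim show ?thesis
          by linarith
      qed
      then show "exp (t * Re z) / cmod z \<le> 1 / dist_weight S t"
        using g z0 by (simp add: field_simps exp_minus)
    qed
  qed
qed

text \<open>A nearest point need not be attained in \<open>S\<close>, so the distance is replaced by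
  a slightly larger \<open>x\<close>: some \<open>z\<close> in \<open>S\<close> then satisfies |z|
  \<le> \<open>s + x\<close> and |Re z| \<le> \<open>x\<close>. Letting \<open>x\<close> decrease to
  the distance gives the claim by continuity.\<close>

lemma exp_segment_dist_bound:
  assumes bound: "\<And>z. z \<in> S \<Longrightarrow> exp (t * Re z) / cmod z \<le> c"
    and t: "t \<ge> 0" and s: "s \<ge> 0" and c: "c > 0"
  shows "1 \<le> c * ((s + segment_dist S s) * exp (t * segment_dist S s))"
proof -
  obtain r where r: "\<bar>r\<bar> \<le> s" "segment_dist S s = infdist (\<i> * complex_of_real r) S"
    using segment_dist_attained[OF s, of S] by metis
  define F where "F = (\<lambda>x. c * ((s + x) * exp (t * x)))"
  have ge: "1 \<le> F x" if x: "x > segment_dist S s" for x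
  proof -
    obtain z where z: "z \<in> S" "dist (\<i> * complex_of_real r) z < x"
      using x r nonempty by (auto simp: infdist_notempty cINF_less_iff)
    have "cmod z \<le> cmod (\<i> * complex_of_real r) + cmod (\<i> * complex_of_real r - z)"
      by (metis norm_triangle_sub norm_minus_commute add.commute)
    then have "cmod z \<le> s + x"
      using r z by (simp add: dist_norm norm_mult)
    moreover have "- Re z \<le> x"
      using z abs_Re_le_cmod[of "\<i> * complex_of_real r - z"] by (simp add: dist_norm)
    moreover have "t * - Re z \<le> t * x"
      using calculation(2) t by (intro mult_left_mono)
    ultimately have "cmod z * exp (t * - Re z) \<le> (s + x) * exp (t * x)"
      by (intro mult_mono) (auto intro: order.trans[OF norm_ge_zero])
    then have "c * (cmod z * exp (t * - Re z)) \<le> F x"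
      using c by (simp add: F_def)
    moreover have "1 \<le> c * (cmod z * exp (t * - Re z))"
      using bound[OF z(1)] Re_neg[OF z(1)] by (cases "z = 0") (auto simp: field_simps exp_minus)
    ultimately show ?thesis
      by linarith
  qed
  have "continuous (at_right (segment_dist S s)) F"
    unfolding F_def by (intro continuous_intros)
  then have "(F \<longlongrightarrow> F (segment_dist S s)) (at_right (segment_dist S s))"
    by (simp add: continuous_within)
  moreover have "eventually (\<lambda>x. 1 \<le> F x) (at_right (segment_dist S s))"
    using ge by (auto simp: eventually_at_filter)
  ultimately have "1 \<le> F (segment_dist S s)"
    by (intro tendsto_lowerbound) auto
  then show ?thesis
    by (simp add: F_def)
qed

text \<open>The two hypotheses say that \<open>f t\<close> is the least upper bound of the
  quotients. It remains to show that \<open>f t * dist_weight S t\<close> tends to 1.\<close>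

lemma asymp_equiv_dist_weight:
  assumes lower: "\<And>t z. t \<ge> 0 \<Longrightarrow> z \<in> S \<Longrightarrow> exp (t * Re z) / cmod z \<le> f t"
    and upper: "\<And>t c. t \<ge> 0 \<Longrightarrow> (\<And>z. z \<in> S \<Longrightarrow> exp (t * Re z) / cmod z \<le> c) \<Longrightarrow> f t \<le> c"
  shows "f \<sim>[at_top] (\<lambda>t. 1 / dist_weight S t)"
proof (rule asymp_equivI')
  have f_pos: "f t > 0" if t: "t \<ge> 0" for t
  proof -
    obtain z where "z \<in> S"
      using nonempty by blast
    moreover from this have "0 < exp (t * Re z) / cmod z"
      using Re_neg[of z] by (cases "z = 0") auto
    ultimately show ?thesis
      using lower[OF t, of z] by linarith
  qed
  have "((\<lambda>t. f t * dist_weight S t) \<longlongrightarrow> 1) at_top"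
  proof (rule order_tendstoI)
    fix a :: real assume "1 < a"
    show "eventually (\<lambda>t. f t * dist_weight S t < a) at_top"
      using exp_Re_div_le eventually_ge_at_top[of 0]
    proof eventually_elim
      case (elim t)
      then have "f t \<le> 1 / dist_weight S t"
        by (intro upper) auto
      with dist_weight_ge_1[of t S] elim \<open>1 < a\<close> show ?case
        by (simp add: field_simps)
    qed
  next
    fix a :: real assume a: "a < 1"
    \<comment> \<open>A number strictly between \<open>a\<close> and 1; the maximum with 1/2 keeps
      it positive even if \<open>a\<close> is negative.\<close>
    define b where "b = max ((a + 1) / 2) (1/2)"
    have b: "0 < b" "b < 1" "a < b"
      using a by (auto simp: b_def less_max_iff_disj field_simps)
    define e where "e = 1 / b - 1"
    have e: "e > 0" "b * (1 + e) = 1"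
      using b by (auto simp: e_def field_simps)
    \<comment> \<open>Beyond \<open>s0\<close> the distance is at most \<open>e * s\<close>, so
      \<open>s + segment_dist S s\<close> exceeds \<open>s\<close> by a factor of at most
      \<open>1 + e = 1 / b\<close>.\<close>
    define s0 where "s0 = max 1 (segment_dist S 0 / e)"
    have s0: "s0 \<ge> 1" "segment_dist S 0 \<le> e * s0"
      using e by (auto simp: s0_def field_simps max_def)
    have half: "(1::real) / 2 > 0"
      by simp
    show "eventually (\<lambda>t. a < f t * dist_weight S t) at_top"
      using eventually_ge_at_top[of 0]
        dist_weight_upper_rate[OF order.trans[OF zero_le_one s0(1)] half]
    proof eventually_elim
      case (elim t)
      have g: "dist_weight S t > 0"
        using dist_weight_ge_1[of t S] elim by linarith
      \<comment> \<open>For \<open>s \<le> s0\<close> the rate bound with constant 1/2 yields the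
        first entry of the minimum, for larger \<open>s\<close> the bound on \<open>f t\<close>
        yields the second. The first entry exceeds the positive weight, so the minimum must be
        \<open>b / f t\<close>.\<close>
      have "min (2 * dist_weight S t) (b / f t) \<le> dist_weight S t"
      proof (rule dist_weight_ge)
        fix s :: real assume s: "s \<ge> 1"
        show "min (2 * dist_weight S t) (b / f t) \<le> s * exp (t * segment_dist S s)"
        proof (cases "s \<le> s0")
          case True
          then have "segment_dist S s0 \<le> segment_dist S s"
            using s by (intro segment_dist_antimono) auto
          then have "1 * exp (t * segment_dist S s0) \<le> s * exp (t * segment_dist S s)"
            using s elim by (intro mult_mono) (auto intro: mult_left_mono)
          with elim show ?thesis
            by linarith
        next
          case False
          have "segment_dist S s \<le> segment_dist S 0"
            using s by (intro segment_dist_antimono) auto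
          also have "\<dots> \<le> e * s"
            using s0 False e by (meson linear mult_left_mono less_imp_le order.trans)
          finally have "s + segment_dist S s \<le> (1 + e) * s"
            by (simp add: algebra_simps)
          then have "f t * ((s + segment_dist S s) * exp (t * segment_dist S s))
              \<le> f t * ((1 + e) * s * exp (t * segment_dist S s))"
            using f_pos[of t] elim by (intro mult_left_mono mult_right_mono) auto
          then have "1 \<le> f t * ((1 + e) * s * exp (t * segment_dist S s))"
            using exp_segment_dist_bound[OF lower[of t] _ _ f_pos[of t], of s] s elim by simp
          then have "b * 1 \<le> b * (f t * ((1 + e) * s * exp (t * segment_dist S s)))"
            using b by (intro mult_left_mono) auto
          also have "\<dots> = b * (1 + e) * (f t * (s * exp (t * segment_dist S s)))"
            by (simp only: mult_ac)
          finally have "b / f t \<le> s * exp (t * segment_dist S s)"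
            using e f_pos[of t] elim by (simp add: field_simps)
          then show ?thesis
            by linarith
        qed
      qed
      then have "b / f t \<le> dist_weight S t"
        using g by linarith
      then show ?case
        using b f_pos[of t] elim by (simp add: field_simps)
    qed
  qed
  then show "((\<lambda>t. f t / (1 / dist_weight S t)) \<longlongrightarrow> 1) at_top"
    by simp
qed

end

section \<open>Passage from the semigroup to its spectrum\<close>

lemma shifted_0: "shifted 0 A = (\<lambda>x. map_option uminus (A x))"
proof -
  have "0 *\<^sub>C x = (0 :: 'a)" for x
    using scaleC_of_real[of 0 x] by simp
  then show ?thesis
    by (simp add: shifted_def)
qed

lemma generator_uminus:
  "generator T x = Some y \<Longrightarrow> generator T (- x) = Some (- y)"
  unfolding generator_eq_Some_iff
  by (drule tendsto_minus) (simp add: blinfun.minus_right algebra_simps)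

text \<open>Shifting by 0 turns the generator into its negative, whence the sign; it disappears when
  norms are taken.\<close>

lemma bounded_inverse_generator:
  assumes "0 \<in> resolvent_set (generator T)"
  shows "bounded_inverse (generator T) = - resolvent 0 (generator T)"
proof (rule bounded_inverse_eqI)
  obtain R where R: "is_bounded_inverse (shifted 0 (generator T)) R"
    using assms by (auto simp: resolvent_set_def boundedly_invertible_def)
  then have "resolvent 0 (generator T) = R"
    by (simp add: resolvent_def bounded_inverse_eqI)
  moreover have "is_bounded_inverse (generator T) (- R)"
    unfolding is_bounded_inverse_def
  proof (intro conjI allI impI)
    fix y
    have "generator T (R y) = Some (- y)"
    proof -
      have "map_option uminus (generator T (R y)) = Some y"
        using R by (simp add: is_bounded_inverse_def shifted_0)
      then show ?thesis
        by auto
    qed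
    then show "generator T (blinfun_apply (- R) y) = Some y"
      using generator_uminus[of T "R y" "- y"] by (simp add: uminus_blinfun.rep_eq)
  next
    fix x y assume "generator T x = Some y"
    then have "shifted 0 (generator T) x = Some (- y)"
      by (simp add: shifted_0)
    then have "R (- y) = x"
      using R by (auto simp: is_bounded_inverse_def)
    then show "blinfun_apply (- R) y = x"
      by (simp add: uminus_blinfun.rep_eq blinfun.minus_right)
  qed
  ultimately show "is_bounded_inverse (generator T) (- resolvent 0 (generator T))"
    by simp
qed

text \<open>Splits the extended real supremum into the two real inequalities that
  \<open>asymp_equiv_dist_weight\<close> expects.\<close>

lemma quasi_multiplication_norm:
  assumes "quasi_multiplication_semigroup T" "\<mu> \<in> resolvent_set (generator T)" "t \<ge> 0"
  shows "z \<in> spectrum (generator T) \<Longrightarrow>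
      exp (t * Re z) / cmod (\<mu> - z) \<le> norm (T t o\<^sub>L resolvent \<mu> (generator T))"
    and "(\<And>z. z \<in> spectrum (generator T) \<Longrightarrow> exp (t * Re z) / cmod (\<mu> - z) \<le> c) \<Longrightarrow>
      norm (T t o\<^sub>L resolvent \<mu> (generator T)) \<le> c"
proof -
  have eq: "ereal (norm (T t o\<^sub>L resolvent \<mu> (generator T))) =
      (SUP z\<in>spectrum (generator T). ereal (exp (t * Re z) / cmod (\<mu> - z)))"
    using assms(1-3) by (auto simp: quasi_multiplication_semigroup_def)
  show "exp (t * Re z) / cmod (\<mu> - z) \<le> norm (T t o\<^sub>L resolvent \<mu> (generator T))"
    if "z \<in> spectrum (generator T)"
  proof -
    have "ereal (exp (t * Re z) / cmod (\<mu> - z))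
        \<le> ereal (norm (T t o\<^sub>L resolvent \<mu> (generator T)))"
      unfolding eq using that by (rule SUP_upper)
    then show ?thesis
      by simp
  qed
  show "norm (T t o\<^sub>L resolvent \<mu> (generator T)) \<le> c"
    if "\<And>z. z \<in> spectrum (generator T) \<Longrightarrow> exp (t * Re z) / cmod (\<mu> - z) \<le> c"
  proof -
    have "ereal (norm (T t o\<^sub>L resolvent \<mu> (generator T))) \<le> ereal c"
      unfolding eq using that by (intro SUP_least) auto
    then show ?thesis
      by simp
  qed
qed

text \<open>At time 0 the defining identity expresses the resolvent norm as the supremum of 1 /
  |\<mu> - z|. Its finiteness keeps the spectrum away from \<mu>, so positivity of the distance
  follows without first proving the spectrum closed. Nonemptiness matters because
  \<open>infdist\<close> to the empty set is 0.\<close>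

lemma quasi_multiplication_resolvent:
  assumes "quasi_multiplication_semigroup T" "\<mu> \<in> resolvent_set (generator T)"
    "spectrum (generator T) \<noteq> {}"
  shows "infdist \<mu> (spectrum (generator T)) > 0"
    and "norm (resolvent \<mu> (generator T)) = 1 / infdist \<mu> (spectrum (generator T))"
proof -
  let ?S = "spectrum (generator T)" and ?N = "norm (resolvent \<mu> (generator T))"
  have "T 0 = id_blinfun"
    using assms(1) by (auto simp: quasi_multiplication_semigroup_def C0_semigroup_def)
  then have T0: "T 0 o\<^sub>L resolvent \<mu> (generator T) = resolvent \<mu> (generator T)"
    by (simp add: blinfun_eqI)
  have le: "1 / dist \<mu> z \<le> ?N" if "z \<in> ?S" for z
    using quasi_multiplication_norm(1)[OF assms(1,2) order.refl that]
    by (simp add: T0 dist_norm)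
  have dist_pos: "dist \<mu> z > 0" if "z \<in> ?S" for z
    using that assms(2) by (auto simp: spectrum_def)
  have N: "?N > 0"
    using assms(3) le dist_pos by (metis all_not_in_conv less_le_trans zero_less_divide_1_iff)
  have "1 / ?N \<le> infdist \<mu> ?S"
    unfolding infdist_notempty[OF assms(3)]
    using le dist_pos N by (intro cINF_greatest assms(3)) (auto simp: field_simps)
  with N show pos: "infdist \<mu> ?S > 0"
    by (meson less_le_trans zero_less_divide_1_iff)
  have "?N \<le> 1 / infdist \<mu> ?S"
    using quasi_multiplication_norm(2)[OF assms(1,2) order.refl, of "1 / infdist \<mu> ?S"]
      infdist_le[of _ ?S \<mu>] dist_pos pos
    by (auto simp: T0 dist_norm field_simps)
  moreover have "1 / infdist \<mu> ?S \<le> ?N"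
    using \<open>1 / ?N \<le> infdist \<mu> ?S\<close> N pos by (simp add: field_simps)
  ultimately show "?N = 1 / infdist \<mu> ?S"
    by simp
qed

theorem theorem4p4:
  fixes T :: "real \<Rightarrow> ('a::complex_banach \<Rightarrow>\<^sub>L 'a)"
    and A :: "'a \<rightharpoonup> 'a"
    and M Mmax :: "real \<Rightarrow> real"
  assumes "quasi_multiplication_semigroup T"
    and "A = generator T"
    and "spectral_bound A = 0"
    and "spectrum A \<inter> {z. Re z = 0} = {}"
    and "\<And>s. s \<ge> 0 \<Longrightarrow> M s = (SUP r\<in>{r. \<bar>r\<bar> \<le> s}. norm (resolvent (\<i> * complex_of_real r) A))"
    and "\<And>s. s \<ge> 1 \<Longrightarrow> Mmax s = (SUP l\<in>{1..s}. M (s / l) * ln l)"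
  shows "(\<lambda>t. norm (T t o\<^sub>L bounded_inverse A)) \<sim>[at_top] (\<lambda>t. 1 / right_inverse 1 Mmax t)"
proof -
  note A = assms(2)
  have bound: "(SUP z\<in>spectrum A. ereal (Re z)) = 0"
    using assms(3) by (simp add: spectral_bound_def)
  \<comment> \<open>Over an empty spectrum the supremum would be minus infinity rather than
    0.\<close>
  have nonempty: "spectrum A \<noteq> {}"
    using bound by (auto simp: bot_ereal_def)
  have imag: "\<i> * complex_of_real r \<in> resolvent_set A" for r
    using assms(4) by (auto simp: spectrum_def)
  interpret left_half_plane_set "spectrum A"
  proof
    fix z assume z: "z \<in> spectrum A"
    then have "ereal (Re z) \<le> 0"
      unfolding bound[symmetric] by (rule SUP_upper)
    then show "Re z < 0"
      using z assms(4) by (auto simp: order.order_iff_strict)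
  next
    fix e :: real assume "e > 0"
    then have "ereal (- e) < (SUP z\<in>spectrum A. ereal (Re z))"
      by (simp add: bound)
    then show "\<exists>z\<in>spectrum A. - e < Re z"
      by (simp add: less_SUP_iff)
  next
    show "infdist (\<i> * complex_of_real r) (spectrum A) > 0" for r
      using quasi_multiplication_resolvent(1) assms(1) imag nonempty unfolding A by blast
  qed
  have "M s = 1 / segment_dist (spectrum A) s" if "s \<ge> 0" for s
    using assms(5)[OF that] SUP_inverse_infdist[OF that]
      quasi_multiplication_resolvent(2)[OF assms(1)] imag nonempty by (simp add: A)
  then have inv: "right_inverse 1 Mmax t = dist_weight (spectrum A) t" if "t \<ge> 0" for t
    using assms(6) that by (rule right_inverse_eq_dist_weight)
  have zero: "0 \<in> resolvent_set (generator T)"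
    using imag[of 0] by (simp add: A)
  have "T t o\<^sub>L bounded_inverse A = - (T t o\<^sub>L resolvent 0 (generator T))" for t
    by (rule blinfun_eqI)
      (simp add: A bounded_inverse_generator[OF zero] uminus_blinfun.rep_eq blinfun.minus_right)
  then have norm_eq: "norm (T t o\<^sub>L bounded_inverse A) = norm (T t o\<^sub>L resolvent 0 (generator T))" for t
    by simp
  have "(\<lambda>t. norm (T t o\<^sub>L bounded_inverse A)) \<sim>[at_top] (\<lambda>t. 1 / dist_weight (spectrum A) t)"
    unfolding norm_eq
    using quasi_multiplication_norm[OF assms(1) zero]
    by (intro asymp_equiv_dist_weight) (auto simp: A)
  also have "eventually (\<lambda>t. 1 / dist_weight (spectrum A) t = 1 / right_inverse 1 Mmax t) at_top"
    using eventually_ge_at_top[of 0] by eventually_elim (simp add: inv)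
  finally show ?thesis .
qed

end
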